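(* Let $V$ be a topological vertex algebra with conformal weights bounded below, $V=\bigoplus_{i\geq k}V^i$. Then the product and bracket $$x\cdot y=\tfrac12\bigl(x_{(-1)}y+(-1)^{p(x)p(y)}y_{(-1)}x\bigr),$$ $$(-1)^{p(x)}[x,y]=\tfrac12\bigl((G_{(0)}x)_{(0)}y+(-1)^{p(x)p(y)}(G_{(0)}y)_{(0)}x\bigr)$$ equip $V^k$ (graded by fermionic degree, with differential $Q_{(0)}$) with the structure of a differential Gerstenhaber algebra.
   Context: All vector spaces are over a field of characteristic zero. A graded vertex superalgebra is a superspace $V=\bigoplus_iV^i$, $V^i=V^i_{ev}\oplus V^i_{odd}$ (with $i$ the conformal weight and $p$ the parity; here $i$ ranges over integers $i\ge k$ for some integer $k$), with a vacuum vector $\mathbf 1\in V^0_{ev}$ and bilinear operations ${}_{(n)}\colon V\times V\to V$, $n\in\mathbb Z$, with $p(a_{(n)}b)=p(a)+p(b)$ and $V^i{}_{(n)}V^j\subset V^{i+j-n-1}$, such that $\mathbf 1_{(n)}a=\delta_{n,-1}a$, $a_{(-1)}\mathbf 1=a$, $a_{(n)}\mathbf 1=0$ for $n\ge0$, and for all $m,n,l\in\mathbb Z$ $$\sum_{j\ge0}\binom mj(a_{(n+j)}b)_{(m+l-j)}c=\sum_{j\ge0}(-1)^j\binom nj\{a_{(m+n-j)}(b_{(l+j)}c)-(-1)^{n+p(a)p(b)}b_{(n+l-j)}(a_{(m+j)}c)\}.$$ For $a\in V$, $a_{(n)}$ also denotes the operator $b\mapsto a_{(n)}b$, and $a(z)=\sum_na_{(n)}z^{-n-1}$.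 A topological vertex algebra is a vertex superalgebra with distinguished elements $L\in V^2_{ev}$ (the Virasoro element), $G\in V^2_{odd}$, $Q\in V^1_{odd}$, $J\in V^1_{ev}$ satisfying $Q_{(0)}^2=0=G_{(1)}^2$ and $[Q_{(0)},G_{(i)}]=L_{(i)}$, and such that $L_{(1)}$ and $J_{(0)}$ are commuting diagonalizable operators whose eigenvalues are the conformal grading and the fermionic grading respectively; modulo 2 the fermionic grading is the parity. The fermionic degrees of $L,G,Q,J$ are $0,-1,1,0$. (In the full standard definition, $L$ is a conformal vector of central charge 0, $L_{(0)}a=a_{(-2)}\mathbf 1$, and for some constant $d$: $Q(z)Q(w)\sim0$, $G(z)G(w)\sim0$, $Q(z)G(w)\sim\frac d{(z-w)^3}+\frac{J(w)}{(z-w)^2}+\frac{L(w)}{z-w}$, $J(z)J(w)\sim\frac d{(z-w)^2}$, $J(z)Q(w)\sim\frac{Q(w)}{z-w}$, $J(z)G(w)\sim-\frac{G(w)}{z-w}$, $L(z)J(w)\sim-\frac d{(z-w)^3}+\frac{J(w)}{(z-w)^2}+\frac{J'(w)}{z-w}$, and $Q$, $G$ are primary of weights 1, 2.) A Gerstenhaber algebra is a graded vector space $W$ with bilinear operations $\cdot$ of degree $0$ and $[\,,]$ of degree $-1$ such that $(W,\cdot)$ is graded commutative associative, $(W[1],[\,,])$ is a graded Lie algebra (where $(W[1])_n=W_{n+1}$), and for each homogeneous $a$ the map $[a,-]\colon W\to W$ is a derivation with respect to $\cdot$. It is a differential Gerstenhaber algebra if it is equipped with a square zero degree 1 map $d$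 which is a (graded) derivation of $\cdot$ on $W$ and of $[\,,]$ on $W[1]$. *)

theory Defs
  imports Complex_Main "HOL-Library.Z2" "HOL-Library.Groups_Big_Fun"
begin

text \<open>Parities live in the two-element field \<^typ>\<open>bit\<close>, so that
  sums and products of parities are field operations and \<^term>\<open>of_int\<close> reduces an integer
  degree modulo 2.\<close>

definition psign :: "bit \<Rightarrow> 'k::ring_1" where
  "psign p = (if p = 0 then 1 else - 1)"

text \<open>\<^term>\<open>A\<close> is the internal direct sum of the subspaces \<^term>\<open>U i\<close>: the summation map
  from finitely supported families to \<^term>\<open>A\<close> is a bijection.\<close>

definition internal_direct_sum ::
    "('k::field \<Rightarrow> 'v::ab_group_add \<Rightarrow> 'v) \<Rightarrow> ('i \<Rightarrow> 'v set) \<Rightarrow> 'v set \<Rightarrow> bool" where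
  "internal_direct_sum scale U A \<longleftrightarrow>
     (\<forall>i. module.subspace scale (U i)) \<and>
     bij_betw Sum_any {f. (\<forall>i. f i \<in> U i) \<and> finite {i. f i \<noteq> 0}} A"

definition integer_eigenspace ::
    "('k::field \<Rightarrow> 'v::ab_group_add \<Rightarrow> 'v) \<Rightarrow> ('v \<Rightarrow> 'v) \<Rightarrow> int \<Rightarrow> 'v set" where
  "integer_eigenspace scale T n = {v. T v = scale (of_int n) v}"

definition integer_diagonalizable ::
    "('k::field \<Rightarrow> 'v::ab_group_add \<Rightarrow> 'v) \<Rightarrow> ('v \<Rightarrow> 'v) \<Rightarrow> bool" where
  "integer_diagonalizable scale T \<longleftrightarrow>
     internal_direct_sum scale (integer_eigenspace scale T) UNIV"

text \<open>A bigraded superspace is given by the pieces \<^term>\<open>V i p\<close> of conformal weight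
  \<^term>\<open>i\<close> and parity \<^term>\<open>p\<close>.\<close>

definition weight_space ::
    "('k::field \<Rightarrow> 'v::ab_group_add \<Rightarrow> 'v) \<Rightarrow> (int \<Rightarrow> bit \<Rightarrow> 'v set) \<Rightarrow> int \<Rightarrow> 'v set" where
  "weight_space scale V i = module.span scale (\<Union>p. V i p)"

definition parity_space ::
    "('k::field \<Rightarrow> 'v::ab_group_add \<Rightarrow> 'v) \<Rightarrow> (int \<Rightarrow> bit \<Rightarrow> 'v set) \<Rightarrow> bit \<Rightarrow> 'v set" where
  "parity_space scale V p = module.span scale (\<Union>i. V i p)"

text \<open>In the following, \<^term>\<open>pr n a b\<close> is the product $a_{(n)}b$. The sums in the Borcherds identity
  are finite because the weights are bounded below (lemma \<open>truncation\<close> below).\<close>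

locale graded_vertex_superalgebra = vector_space scale
  for scale :: "'k::field_char_0 \<Rightarrow> 'v::ab_group_add \<Rightarrow> 'v" (infixr \<open>*s\<close> 75) +
  fixes k :: int
    and V :: "int \<Rightarrow> bit \<Rightarrow> 'v set"
    and pr :: "int \<Rightarrow> 'v \<Rightarrow> 'v \<Rightarrow> 'v"
    and vac :: 'v
  assumes direct_sum: "internal_direct_sum scale (\<lambda>(i, p). V i p) UNIV"
    and bounded_below: "i < k \<Longrightarrow> V i p = {0}"
    and vac_mem: "vac \<in> V 0 0"
    and linear_left: "Vector_Spaces.linear scale scale (\<lambda>a. pr n a b)"
    and linear_right: "Vector_Spaces.linear scale scale (pr n a)"
    and pr_mem: "a \<in> V i p \<Longrightarrow> b \<in> V j q \<Longrightarrow> pr n a b \<in> V (i + j - n - 1) (p + q)"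
    and vac_left: "pr n vac a = (if n = - 1 then a else 0)"
    and vac_right: "pr (- 1) a vac = a"
    and vac_right_nonneg: "n \<ge> 0 \<Longrightarrow> pr n a vac = 0"
    and borcherds: "a \<in> V i p \<Longrightarrow> b \<in> V i' q \<Longrightarrow>
      (\<Sum>j::nat. (of_int m gchoose j) *s pr (m + l - int j) (pr (n + int j) a b) c) =
      (\<Sum>j::nat. ((- 1) ^ j * (of_int n gchoose j)) *s
         (pr (m + n - int j) a (pr (l + int j) b c)
          - ((- 1) powi n * psign (p * q)) *s pr (n + l - int j) b (pr (m + int j) a c)))"

definition fermionic_space ::
    "('k::field \<Rightarrow> 'v::ab_group_add \<Rightarrow> 'v) \<Rightarrow> (int \<Rightarrow> 'v \<Rightarrow> 'v \<Rightarrow> 'v) \<Rightarrow> 'v \<Rightarrow> int \<Rightarrow> 'v set" where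
  "fermionic_space scale pr J f = integer_eigenspace scale (pr 0 J) f"

locale topological_vertex_algebra = graded_vertex_superalgebra scale k V pr vac
  for scale :: "'k::field_char_0 \<Rightarrow> 'v::ab_group_add \<Rightarrow> 'v" (infixr \<open>*s\<close> 75)
    and k V pr vac +
  fixes L G Q J :: 'v
  assumes L_mem: "L \<in> V 2 0"
    and G_mem: "G \<in> V 2 1"
    and Q_mem: "Q \<in> V 1 1"
    and J_mem: "J \<in> V 1 0"
    and Q0_square: "pr 0 Q (pr 0 Q a) = 0"
    and G1_square: "pr 1 G (pr 1 G a) = 0"
    \<comment> \<open>\<^term>\<open>Q\<close> and \<^term>\<open>G\<close> are odd, so the bracket of the operators is the anticommutator.\<close>
    and Q0_G: "pr 0 Q (pr i G a) + pr i G (pr 0 Q a) = pr i L a"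
    and L1_J0_commute: "pr 1 L (pr 0 J a) = pr 0 J (pr 1 L a)"
    and L1_diagonalizable: "integer_diagonalizable scale (pr 1 L)"
    and J0_diagonalizable: "integer_diagonalizable scale (pr 0 J)"
    and conformal_grading: "weight_space scale V i = integer_eigenspace scale (pr 1 L) i"
    and fermionic_parity: "fermionic_space scale pr J f \<subseteq> parity_space scale V (of_int f)"
    and L_fermionic: "L \<in> fermionic_space scale pr J 0"
    and G_fermionic: "G \<in> fermionic_space scale pr J (- 1)"
    and Q_fermionic: "Q \<in> fermionic_space scale pr J 1"
    and J_fermionic: "J \<in> fermionic_space scale pr J 0"

text \<open>The product and the bracket are given by formulas in parity-homogeneous arguments and are
  extended bilinearly, by splitting each argument into its even and odd part (see \<open>tva_mult_homogeneous\<close> and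
  \<open>tva_bracket_homogeneous\<close> below).\<close>

definition parity_part ::
    "('k::field \<Rightarrow> 'v::ab_group_add \<Rightarrow> 'v) \<Rightarrow> (int \<Rightarrow> bit \<Rightarrow> 'v set) \<Rightarrow> bit \<Rightarrow> 'v \<Rightarrow> 'v" where
  "parity_part scale V p x =
     (THE u. u \<in> parity_space scale V p \<and> x - u \<in> parity_space scale V (p + 1))"

definition tva_mult ::
    "('k::field_char_0 \<Rightarrow> 'v::ab_group_add \<Rightarrow> 'v) \<Rightarrow> (int \<Rightarrow> bit \<Rightarrow> 'v set) \<Rightarrow>
     (int \<Rightarrow> 'v \<Rightarrow> 'v \<Rightarrow> 'v) \<Rightarrow> 'v \<Rightarrow> 'v \<Rightarrow> 'v" where
  "tva_mult scale V pr x y =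
     (\<Sum>p\<in>{0, 1}. \<Sum>q\<in>{0, 1}.
        let u = parity_part scale V p x; v = parity_part scale V q y in
        scale (1 / 2) (pr (- 1) u v + scale (psign (p * q)) (pr (- 1) v u)))"

definition tva_bracket ::
    "('k::field_char_0 \<Rightarrow> 'v::ab_group_add \<Rightarrow> 'v) \<Rightarrow> (int \<Rightarrow> bit \<Rightarrow> 'v set) \<Rightarrow>
     (int \<Rightarrow> 'v \<Rightarrow> 'v \<Rightarrow> 'v) \<Rightarrow> 'v \<Rightarrow> 'v \<Rightarrow> 'v \<Rightarrow> 'v" where
  "tva_bracket scale V pr G x y =
     (\<Sum>p\<in>{0, 1}. \<Sum>q\<in>{0, 1}.
        let u = parity_part scale V p x; v = parity_part scale V q y in
        scale (psign p * (1 / 2))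
          (pr 0 (pr 0 G u) v + scale (psign (p * q)) (pr 0 (pr 0 G v) u)))"

text \<open>Graded spaces are subspaces \<^term>\<open>A\<close> of an ambient vector space with a decomposition
  \<^term>\<open>W\<close>; operations are functions on the ambient space considered on \<^term>\<open>A\<close> only.\<close>

definition bilinear_on ::
    "('k::field \<Rightarrow> 'v::ab_group_add \<Rightarrow> 'v) \<Rightarrow> 'v set \<Rightarrow> ('v \<Rightarrow> 'v \<Rightarrow> 'v) \<Rightarrow> bool" where
  "bilinear_on scale A f \<longleftrightarrow>
     (\<forall>x\<in>A. \<forall>y\<in>A. f x y \<in> A) \<and>
     (\<forall>x\<in>A. \<forall>y\<in>A. \<forall>z\<in>A. f (x + y) z = f x z + f y z \<and> f x (y + z) = f x y + f x z) \<and>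
     (\<forall>c. \<forall>x\<in>A. \<forall>y\<in>A. f (scale c x) y = scale c (f x y) \<and> f x (scale c y) = scale c (f x y))"

definition linear_on ::
    "('k::field \<Rightarrow> 'v::ab_group_add \<Rightarrow> 'v) \<Rightarrow> 'v set \<Rightarrow> ('v \<Rightarrow> 'v) \<Rightarrow> bool" where
  "linear_on scale A D \<longleftrightarrow>
     (\<forall>x\<in>A. D x \<in> A) \<and> (\<forall>x\<in>A. \<forall>y\<in>A. D (x + y) = D x + D y) \<and>
     (\<forall>c. \<forall>x\<in>A. D (scale c x) = scale c (D x))"

definition bilinear_of_degree ::
    "('k::field \<Rightarrow> 'v::ab_group_add \<Rightarrow> 'v) \<Rightarrow> 'v set \<Rightarrow> (int \<Rightarrow> 'v set) \<Rightarrow> int \<Rightarrow>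
     ('v \<Rightarrow> 'v \<Rightarrow> 'v) \<Rightarrow> bool" where
  "bilinear_of_degree scale A W e f \<longleftrightarrow>
     bilinear_on scale A f \<and> (\<forall>m n. \<forall>x\<in>W m. \<forall>y\<in>W n. f x y \<in> W (m + n + e))"

definition graded_derivation ::
    "('k::field \<Rightarrow> 'v::ab_group_add \<Rightarrow> 'v) \<Rightarrow> 'v set \<Rightarrow> (int \<Rightarrow> 'v set) \<Rightarrow>
     ('v \<Rightarrow> 'v \<Rightarrow> 'v) \<Rightarrow> int \<Rightarrow> ('v \<Rightarrow> 'v) \<Rightarrow> bool" where
  "graded_derivation scale A W f e D \<longleftrightarrow>
     linear_on scale A D \<and> (\<forall>m. \<forall>x\<in>W m. D x \<in> W (m + e)) \<and>
     (\<forall>m. \<forall>x\<in>W m. \<forall>y\<in>A. D (f x y) = f (D x) y + scale ((- 1) powi (e * m)) (f x (D y)))"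

definition graded_commutative_associative ::
    "('k::field \<Rightarrow> 'v::ab_group_add \<Rightarrow> 'v) \<Rightarrow> 'v set \<Rightarrow> (int \<Rightarrow> 'v set) \<Rightarrow>
     ('v \<Rightarrow> 'v \<Rightarrow> 'v) \<Rightarrow> bool" where
  "graded_commutative_associative scale A W f \<longleftrightarrow>
     bilinear_of_degree scale A W 0 f \<and>
     (\<forall>m n. \<forall>x\<in>W m. \<forall>y\<in>W n. f x y = scale ((- 1) powi (m * n)) (f y x)) \<and>
     (\<forall>x\<in>A. \<forall>y\<in>A. \<forall>z\<in>A. f (f x y) z = f x (f y z))"

text \<open>In characteristic zero, graded antisymmetry and the graded Jacobi identity suffice.\<close>

definition graded_lie_algebra ::
    "('k::field_char_0 \<Rightarrow> 'v::ab_group_add \<Rightarrow> 'v) \<Rightarrow> 'v set \<Rightarrow> (int \<Rightarrow> 'v set) \<Rightarrow>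
     ('v \<Rightarrow> 'v \<Rightarrow> 'v) \<Rightarrow> bool" where
  "graded_lie_algebra scale A W br \<longleftrightarrow>
     bilinear_of_degree scale A W 0 br \<and>
     (\<forall>m n. \<forall>x\<in>W m. \<forall>y\<in>W n. br x y = - scale ((- 1) powi (m * n)) (br y x)) \<and>
     (\<forall>m n. \<forall>x\<in>W m. \<forall>y\<in>W n. \<forall>z\<in>A.
        br x (br y z) = br (br x y) z + scale ((- 1) powi (m * n)) (br y (br x z)))"

definition shift1 :: "(int \<Rightarrow> 'v set) \<Rightarrow> int \<Rightarrow> 'v set" where
  "shift1 W n = W (n + 1)"

definition gerstenhaber_algebra ::
    "('k::field_char_0 \<Rightarrow> 'v::ab_group_add \<Rightarrow> 'v) \<Rightarrow> 'v set \<Rightarrow> (int \<Rightarrow> 'v set) \<Rightarrow>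
     ('v \<Rightarrow> 'v \<Rightarrow> 'v) \<Rightarrow> ('v \<Rightarrow> 'v \<Rightarrow> 'v) \<Rightarrow> bool" where
  "gerstenhaber_algebra scale A W mult br \<longleftrightarrow>
     vector_space scale \<and> module.subspace scale A \<and> internal_direct_sum scale W A \<and>
     bilinear_of_degree scale A W 0 mult \<and>
     bilinear_of_degree scale A W (- 1) br \<and>
     graded_commutative_associative scale A W mult \<and>
     graded_lie_algebra scale A (shift1 W) br \<and>
     (\<forall>m. \<forall>a\<in>W m. graded_derivation scale A W mult (m - 1) (br a))"

definition differential_gerstenhaber_algebra ::
    "('k::field_char_0 \<Rightarrow> 'v::ab_group_add \<Rightarrow> 'v) \<Rightarrow> 'v set \<Rightarrow> (int \<Rightarrow> 'v set) \<Rightarrow>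
     ('v \<Rightarrow> 'v \<Rightarrow> 'v) \<Rightarrow> ('v \<Rightarrow> 'v \<Rightarrow> 'v) \<Rightarrow> ('v \<Rightarrow> 'v) \<Rightarrow> bool" where
  "differential_gerstenhaber_algebra scale A W mult br d \<longleftrightarrow>
     gerstenhaber_algebra scale A W mult br \<and>
     (\<forall>x\<in>A. d (d x) = 0) \<and>
     graded_derivation scale A W mult 1 d \<and>
     graded_derivation scale A (shift1 W) br 1 d"

context graded_vertex_superalgebra
begin

lemma decompose:
  obtains f where "\<And>i p. f (i, p) \<in> V i p" "finite {x. f x \<noteq> 0}" "x = Sum_any f"
proof -
  have "x \<in> Sum_any ` {f. (\<forall>i. f i \<in> (case i of (i, p) \<Rightarrow> V i p)) \<and> finite {i. f i \<noteq> 0}}"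
    using direct_sum by (simp add: internal_direct_sum_def bij_betw_def)
  then show thesis using that by fastforce
qed

lemma V_subspace: "subspace (V i p)"
  using direct_sum by (auto simp: internal_direct_sum_def dest: spec[of _ "(i, p)"])

lemma truncation:
  assumes "a \<in> V i p"
  shows "\<exists>N. \<forall>n\<ge>N. pr n a b = 0"
proof -
  obtain f where f: "\<And>i p. f (i, p) \<in> V i p" "finite {x. f x \<noteq> 0}" "b = Sum_any f"
    using decompose by blast
  interpret l: Vector_Spaces.linear scale scale "pr n a" for n by (rule linear_right)
  have b: "b = sum f {x. f x \<noteq> 0}" using f by (simp add: Sum_any.expand_set)
  define N where "N = Max (insert 0 ((\<lambda>(j, q). i + j - k) ` {x. f x \<noteq> 0}))"
  have "pr n a b = 0" if "n \<ge> N" for n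
  proof -
    have "pr n a (f x) = 0" if x: "f x \<noteq> 0" for x
    proof -
      obtain j q where [simp]: "x = (j, q)" by (cases x)
      have "i + j - k \<le> N" unfolding N_def using x f(2) by (intro Max_ge) force+
      then have "V (i + j - n - 1) (p + q) = {0}" using \<open>n \<ge> N\<close> by (intro bounded_below) simp
      then show ?thesis using pr_mem[OF assms f(1), of n j q] by simp
    qed
    then show ?thesis unfolding b l.sum by simp
  qed
  then show ?thesis by blast
qed

lemma parity_space_decompose:
  assumes "x \<in> parity_space scale V p"
  shows "\<exists>f. (\<forall>i q. f (i, q) \<in> V i q) \<and> finite {z. f z \<noteq> 0} \<and> x = Sum_any f \<and>
             (\<forall>i q. q \<noteq> p \<longrightarrow> f (i, q) = 0)"
  using assms unfolding parity_space_def
proof (induction rule: span_induct_alt)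
  case base
  show ?case by (rule exI[of _ "\<lambda>_. 0"]) (simp add: subspace_0[OF V_subspace])
next
  case (step c v y)
  then obtain f where f: "\<forall>i q. f (i, q) \<in> V i q" "finite {z. f z \<noteq> 0}" "y = Sum_any f"
    "\<forall>i q. q \<noteq> p \<longrightarrow> f (i, q) = 0" by blast
  obtain i0 where i0: "v \<in> V i0 p" using step by blast
  define g where "g = (\<lambda>z. if z = (i0, p) then c *s v else 0)"
  have g: "finite {z. g z \<noteq> 0}" by (rule finite_subset[of _ "{(i0, p)}"]) (auto simp: g_def)
  have "Sum_any g = sum g {(i0, p)}"
    by (rule Sum_any.expand_superset) (auto simp: g_def)
  then have sg: "Sum_any g = c *s v" by (simp add: g_def)
  have "finite {z. g z + f z \<noteq> 0}"
    by (rule finite_subset[OF _ finite_UnI[OF g f(2)]]) auto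
  moreover have "c *s v + y = (\<Sum>z. g z + f z)"
    using Sum_any.distrib[OF g f(2)] sg f(3) by simp
  moreover have "g (i, q) + f (i, q) \<in> V i q" for i q
    using f(1) i0 by (auto simp: g_def intro!: subspace_add[OF V_subspace] subspace_scale[OF V_subspace])
  moreover have "q \<noteq> p \<longrightarrow> g (i, q) + f (i, q) = 0" for i q
    using f(4) by (simp add: g_def)
  ultimately show ?case by (intro exI[of _ "\<lambda>z. g z + f z"]) auto
qed

lemma parity_spaces_disjoint:
  assumes "x \<in> parity_space scale V p" "x \<in> parity_space scale V q" "p \<noteq> q"
  shows "x = 0"
proof -
  obtain f g where f: "\<forall>i q. f (i, q) \<in> V i q" "finite {z. f z \<noteq> 0}" "x = Sum_any f"
      "\<forall>i r. r \<noteq> p \<longrightarrow> f (i, r) = 0"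
    and g: "\<forall>i q. g (i, q) \<in> V i q" "finite {z. g z \<noteq> 0}" "x = Sum_any g"
      "\<forall>i r. r \<noteq> q \<longrightarrow> g (i, r) = 0"
    using parity_space_decompose[OF assms(1)] parity_space_decompose[OF assms(2)] by (elim exE conjE) blast
  have "inj_on Sum_any {f. (\<forall>i. f i \<in> (case i of (i, p) \<Rightarrow> V i p)) \<and> finite {i. f i \<noteq> 0}}"
    using direct_sum by (simp add: internal_direct_sum_def bij_betw_def)
  then have "f = g" by (rule inj_onD) (use f g in auto)
  then have "f (i, r) = 0" for i r using f(4) g(4) assms(3) by metis
  then have "f = (\<lambda>_. 0)" by auto
  then show ?thesis using f(3) by simp
qed

lemma parity_part_homogeneous:
  assumes "x \<in> parity_space scale V p"
  shows "parity_part scale V q x = (if q = p then x else 0)"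
proof -
  have sub: "subspace (parity_space scale V r)" for r by (simp add: parity_space_def)
  have ne: "r \<noteq> r + 1" for r :: bit by (cases r) auto
  have pq: "q \<noteq> p \<Longrightarrow> q + 1 = p" by (cases p; cases q) auto
  show ?thesis unfolding parity_part_def
  proof (rule the_equality)
    show "(if q = p then x else 0) \<in> parity_space scale V q \<and>
        x - (if q = p then x else 0) \<in> parity_space scale V (q + 1)"
      using assms pq subspace_0[OF sub] by auto
  next
    fix u
    assume u: "u \<in> parity_space scale V q \<and> x - u \<in> parity_space scale V (q + 1)"
    show "u = (if q = p then x else 0)"
    proof (cases "q = p")
      case True
      then have "x - u \<in> parity_space scale V q" using u assms subspace_diff[OF sub] by blast
      then have "x - u = 0" using u by (intro parity_spaces_disjoint[OF _ _ ne]) auto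
      then show ?thesis using True by simp
    next
      case False
      then have "x - (x - u) \<in> parity_space scale V (q + 1)"
        using u assms pq subspace_diff[OF sub] by blast
      then have "u = 0" using u by (intro parity_spaces_disjoint[OF _ _ ne]) auto
      then show ?thesis using False by simp
    qed
  qed
qed

lemma tva_mult_homogeneous:
  assumes "x \<in> parity_space scale V p" "y \<in> parity_space scale V q"
  shows "tva_mult scale V pr x y = (1 / 2) *s (pr (- 1) x y + psign (p * q) *s pr (- 1) y x)"
proof -
  interpret l: Vector_Spaces.linear scale scale "pr n a" for n a by (rule linear_right)
  interpret r: Vector_Spaces.linear scale scale "\<lambda>a. pr n a b" for n b by (rule linear_left)
  show ?thesis
    by (cases p; cases q)
      (simp_all add: tva_mult_def parity_part_homogeneous[OF assms(1)]
        parity_part_homogeneous[OF assms(2)] Let_def l.zero r.zero)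
qed

lemma tva_bracket_homogeneous:
  assumes "x \<in> parity_space scale V p" "y \<in> parity_space scale V q"
  shows "psign p *s tva_bracket scale V pr G x y =
    (1 / 2) *s (pr 0 (pr 0 G x) y + psign (p * q) *s pr 0 (pr 0 G y) x)"
proof -
  interpret l: Vector_Spaces.linear scale scale "pr n a" for n a by (rule linear_right)
  interpret r: Vector_Spaces.linear scale scale "\<lambda>a. pr n a b" for n b by (rule linear_left)
  show ?thesis
    by (cases p; cases q)
      (simp_all add: tva_bracket_def parity_part_homogeneous[OF assms(1)] psign_def
        parity_part_homogeneous[OF assms(2)] Let_def l.zero r.zero)
qed

end

end

theory Submission
  imports Defs
begin

text \<open>If \<open>k > 0\<close> then the vacuum, hence the whole space, vanishes; if \<open>k < 0\<close> then product and bracket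
  land in the zero space of weight \<open>2k\<close>. The case \<open>k = 0\<close> needs no separation from these: a product
  of weight less than \<open>2k\<close> is always zero, and one of weight \<open>2k\<close> always lies in the piece of weight \<open>k\<close>.
  For lowest-weight \<open>x\<close>, \<open>y\<close> the vanishing products leave only the leading terms of skew symmetry, so that
  the product is \<open>x\<^sub>(\<^sub>-\<^sub>1\<^sub>) y\<close> and the bracket is \<open>(G\<^sub>(\<^sub>0\<^sub>) x)\<^sub>(\<^sub>0\<^sub>) y\<close> up to sign, and everything follows
  from the fact that \<open>a\<^sub>(\<^sub>0\<^sub>)\<close> is a superderivation of all products. The Jacobi identity uses
  \<open>G\<^sub>(\<^sub>0\<^sub>)\<^sup>2 = 0\<close>, which is derived from \<open>G\<^sub>(\<^sub>1\<^sub>)\<^sup>2 = 0\<close>, and compatibility of \<open>Q\<^sub>(\<^sub>0\<^sub>)\<close> with the bracket uses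
  \<open>(L\<^sub>(\<^sub>0\<^sub>) x)\<^sub>(\<^sub>0\<^sub>) y = 0\<close>.\<close>

section \<open>Signs, uniqueness in direct sums, and commuting eigenspaces\<close>

lemma bit_exhaust: "p = 0 \<or> p = (1::bit)"
  by (cases p) auto

text \<open>Bridge between the two sign conventions: the vertex algebra signs depend on parities in
  \<open>bit\<close>, those of a Gerstenhaber algebra on integer degrees.\<close>

lemma psign_of_int: "psign (of_int m) = ((- 1) powi m :: 'k::field)"
  by (cases "even m") (auto simp: psign_def power_int_minus_left elim!: evenE oddE)

lemma internal_direct_sum_unique:
  assumes "internal_direct_sum scale U A"
    and "\<And>i. f i \<in> U i" "finite {i. f i \<noteq> 0}" "\<And>i. g i \<in> U i" "finite {i. g i \<noteq> 0}"
    and "Sum_any f = Sum_any g"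
  shows "f = g"
  using assms unfolding internal_direct_sum_def bij_betw_def by (blast dest: inj_onD)

context vector_space
begin

text \<open>The components of an eigenvector of \<^term>\<open>S\<close> are again eigenvectors of \<^term>\<open>S\<close>, by uniqueness
  of the decomposition.\<close>

lemma internal_direct_sum_eigenspace:
  assumes diag: "integer_diagonalizable scale T"
    and T: "Vector_Spaces.linear scale scale T" and S: "Vector_Spaces.linear scale scale S"
    and commute: "\<And>v. S (T v) = T (S v)"
  shows "internal_direct_sum scale
    (\<lambda>n. integer_eigenspace scale S k \<inter> integer_eigenspace scale T n)
    (integer_eigenspace scale S k)"
proof -
  interpret T: Vector_Spaces.linear scale scale T by (rule T)
  interpret S: Vector_Spaces.linear scale scale S by (rule S)
  let ?E = "integer_eigenspace scale S k"
  have ds: "internal_direct_sum scale (integer_eigenspace scale T) UNIV"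
    using diag by (simp add: integer_diagonalizable_def)
  have subE: "subspace ?E"
    by (auto simp: subspace_def integer_eigenspace_def S.add S.scale scale_right_distrib S.zero
        scale_left_commute)
  have subT: "subspace (integer_eigenspace scale T n)" for n
    using ds by (simp add: internal_direct_sum_def)
  have inj: "inj_on Sum_any {f. (\<forall>n. f n \<in> ?E \<inter> integer_eigenspace scale T n) \<and> finite {n. f n \<noteq> 0}}"
    using ds unfolding internal_direct_sum_def bij_betw_def by (auto elim: inj_on_subset)
  have "Sum_any f \<in> ?E" if "\<And>n. f n \<in> ?E" for f :: "int \<Rightarrow> 'b"
    unfolding Sum_any.expand_set by (rule subspace_sum[OF subE]) (use that in auto)
  moreover have "x \<in> Sum_any ` {f. (\<forall>n. f n \<in> ?E \<inter> integer_eigenspace scale T n) \<and> finite {n. f n \<noteq> 0}}"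
    if x: "x \<in> ?E" for x
  proof -
    have "x \<in> Sum_any ` {f. (\<forall>n. f n \<in> integer_eigenspace scale T n) \<and> finite {n. f n \<noteq> 0}}"
      using ds by (simp add: internal_direct_sum_def bij_betw_def)
    then obtain f where f: "\<And>n. f n \<in> integer_eigenspace scale T n" "finite {n. f n \<noteq> 0}"
      and xf: "x = Sum_any f" by auto
    have fin: "finite {n. S (f n) \<noteq> 0}" "finite {n. of_int k *s f n \<noteq> 0}"
      by (rule finite_subset[OF _ f(2)]; auto simp: S.zero)+
    have "(\<lambda>n. S (f n)) = (\<lambda>n. of_int k *s f n)"
    proof (rule internal_direct_sum_unique[OF ds _ fin(1) _ fin(2)])
      show "S (f n) \<in> integer_eigenspace scale T n" for n
        using f(1)[of n] by (simp add: integer_eigenspace_def flip: commute) (simp add: S.scale)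
      show "of_int k *s f n \<in> integer_eigenspace scale T n" for n
        by (intro subspace_scale subT f(1))
      have "Sum_any (\<lambda>n. S (f n)) = (\<Sum>n\<in>{n. f n \<noteq> 0}. S (f n))"
        by (rule Sum_any.expand_superset[OF f(2)]) (auto simp: S.zero)
      also have "\<dots> = S x" by (simp add: xf Sum_any.expand_set S.sum)
      also have "\<dots> = of_int k *s x" using x by (simp add: integer_eigenspace_def)
      also have "\<dots> = (\<Sum>n\<in>{n. f n \<noteq> 0}. of_int k *s f n)"
        by (simp add: xf Sum_any.expand_set scale_sum_right)
      also have "\<dots> = Sum_any (\<lambda>n. of_int k *s f n)"
        by (rule Sum_any.expand_superset[symmetric, OF f(2)]) auto
      finally show "Sum_any (\<lambda>n. S (f n)) = Sum_any (\<lambda>n. of_int k *s f n)" .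
    qed
    then have "f n \<in> ?E" for n by (simp add: integer_eigenspace_def fun_eq_iff)
    then show ?thesis using f xf by blast
  qed
  ultimately show ?thesis
    unfolding internal_direct_sum_def bij_betw_def using inj subE subT
    by (auto intro!: subspace_inter)
qed

end

section \<open>Splitting the weight spaces by parity\<close>

context graded_vertex_superalgebra
begin

lemma scale_half: "(1 / 2) *s (x + x) = x"
  by (simp add: scale_right_distrib flip: scale_left_distrib)

sublocale pr_right: Vector_Spaces.linear scale scale "pr n a" for n a
  by (rule linear_right)

sublocale pr_left: Vector_Spaces.linear scale scale "\<lambda>a. pr n a b" for n b
  by (rule linear_left)

lemmas pr_linear = pr_right.zero pr_right.add pr_right.diff pr_right.neg pr_right.scale
  pr_left.zero pr_left.add pr_left.diff pr_left.neg pr_left.scale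

lemma parity_space_subspace: "subspace (parity_space scale V p)"
  by (simp add: parity_space_def)

lemma weight_space_subspace: "subspace (weight_space scale V i)"
  by (simp add: weight_space_def)

lemma V_subset_parity_space: "V i p \<subseteq> parity_space scale V p"
  unfolding parity_space_def by (meson UNIV_I UN_upper order_trans span_superset)

lemma V_subset_weight_space: "V i p \<subseteq> weight_space scale V i"
  unfolding weight_space_def by (meson UNIV_I UN_upper order_trans span_superset)

lemma weight_space_cases:
  assumes "x \<in> weight_space scale V i"
  obtains u v where "u \<in> V i 0" "v \<in> V i 1" "x = u + v"
proof -
  have V_union: "(\<Union>p. V i p) = V i 0 \<union> V i 1" 
  proof (intro equalityI subsetI)
    fix v assume "v \<in> (\<Union>p. V i p)"
    then obtain p where "v \<in> V i p" by blast
    then show "v \<in> V i 0 \<union> V i 1" using bit_exhaust[of p] by auto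
  qed auto
  have span_V: "span (V i p) = V i p" for p
    by (rule span_eq_iff[THEN iffD2, OF V_subspace])
  have "x \<in> (\<lambda>(u, v). u + v) ` (V i 0 \<times> V i 1)"
    using assms unfolding weight_space_def V_union span_Un span_V by auto
  then show thesis using that by auto
qed

lemma parity_part_sum:
  assumes u: "u \<in> parity_space scale V 0" and v: "v \<in> parity_space scale V 1"
  shows "parity_part scale V 0 (u + v) = u" "parity_part scale V 1 (u + v) = v"
proof -
  have *: "u' = u" if u': "u' \<in> parity_space scale V 0" and "u + v - u' \<in> parity_space scale V 1" for u'
  proof -
    have "u + v - u' - v \<in> parity_space scale V 1"
      using that(2) v by (rule subspace_diff[OF parity_space_subspace])
    moreover have "u - u' \<in> parity_space scale V 0"
      using u u' by (rule subspace_diff[OF parity_space_subspace])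
    ultimately have "u - u' = 0" by (intro parity_spaces_disjoint[of _ 0 1]) simp_all
    then show ?thesis by simp
  qed
  show "parity_part scale V 0 (u + v) = u"
    unfolding parity_part_def by (rule the_equality) (use u v * in auto)
  show "parity_part scale V 1 (u + v) = v"
    unfolding parity_part_def
  proof (rule the_equality)
    fix w assume "w \<in> parity_space scale V 1 \<and> u + v - w \<in> parity_space scale V (1 + 1)"
    then have "u + v - w = u" by (intro *) auto
    then show "w = v" by (simp add: algebra_simps)
  qed (use u v in auto)
qed

lemma V_parity_space: "x \<in> V i p \<Longrightarrow> x \<in> parity_space scale V p"
  using V_subset_parity_space by blast

text \<open>Weight and parity spaces are separate spans, so their intersection has to be identified:
  the weight splits \<open>x\<close> inside a single weight, and uniqueness of parity parts makes
  one summand equal to \<open>x\<close>.\<close>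

lemma weight_parity_space:
  assumes "x \<in> weight_space scale V i" "x \<in> parity_space scale V p"
  shows "x \<in> V i p"
proof -
  obtain u v where uv: "u \<in> V i 0" "v \<in> V i 1" and x: "x = u + v"
    using weight_space_cases[OF assms(1)] .
  have "parity_part scale V 0 x = u" "parity_part scale V 1 x = v"
    unfolding x by (intro parity_part_sum uv[THEN V_parity_space])+
  then have "p = 0 \<and> x = u \<or> p = 1 \<and> x = v"
    using bit_exhaust[of p] parity_part_homogeneous[OF assms(2)] by metis
  then show ?thesis using uv by auto
qed

lemma tva_mult_sum:
  assumes "x0 \<in> parity_space scale V 0" "x1 \<in> parity_space scale V 1"
    "y0 \<in> parity_space scale V 0" "y1 \<in> parity_space scale V 1"
  shows "tva_mult scale V pr (x0 + x1) (y0 + y1) =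
    tva_mult scale V pr x0 y0 + tva_mult scale V pr x0 y1 +
    tva_mult scale V pr x1 y0 + tva_mult scale V pr x1 y1"
  by (simp add: tva_mult_def Let_def parity_part_sum[OF assms(1,2)] parity_part_sum[OF assms(3,4)]
      assms[THEN parity_part_homogeneous] pr_right.zero pr_left.zero)

lemma tva_bracket_sum:
  assumes "x0 \<in> parity_space scale V 0" "x1 \<in> parity_space scale V 1"
    "y0 \<in> parity_space scale V 0" "y1 \<in> parity_space scale V 1"
  shows "tva_bracket scale V pr G (x0 + x1) (y0 + y1) =
    tva_bracket scale V pr G x0 y0 + tva_bracket scale V pr G x0 y1 +
    tva_bracket scale V pr G x1 y0 + tva_bracket scale V pr G x1 y1"
  by (simp add: tva_bracket_def Let_def parity_part_sum[OF assms(1,2)]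
      parity_part_sum[OF assms(3,4)] assms[THEN parity_part_homogeneous] pr_right.zero pr_left.zero)

section \<open>Consequences of the lower bound on weights\<close>

lemma pr_above_weight:
  assumes "a \<in> V i p" "b \<in> V j q" "i + j - n - 1 < 2 * k"
  shows "pr n a b = 0"
proof (cases "k \<le> 0")
  case True
  \<comment> \<open>Since \<open>k \<le> 0\<close> gives \<open>2 * k \<le> k\<close>, the weight of
    the product lies below the lower bound.\<close>
  have "V (i + j - n - 1) (p + q) = {0}" using assms(3) True by (intro bounded_below) simp
  then show ?thesis using pr_mem[OF assms(1,2), of n] by simp
next
  case False
  then have "vac = 0" using vac_mem bounded_below[of 0] by auto
  then show ?thesis using vac_right[of "pr n a b"] by (simp add: pr_linear)
qed

text \<open>The weight is \<open>2 * k\<close>, which is \<open>k\<close> exactly when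
  \<open>k = 0\<close>; for any other \<open>k\<close> the product is zero and membership in
  \<open>V k (p + q)\<close> is trivial.\<close>

lemma pr_mem_lowest:
  assumes "a \<in> V i p" "b \<in> V j q" "i + j - n - 1 = 2 * k"
  shows "pr n a b \<in> V k (p + q)"
proof (cases "k = 0")
  case True
  then show ?thesis using pr_mem[OF assms(1,2), of n] assms(3) by simp
next
  case False
  have "pr n a b = 0"
  proof (cases "k < 0")
    case True
    then have "V (2 * k) (p + q) = {0}" by (intro bounded_below) simp
    then show ?thesis using pr_mem[OF assms(1,2), of n] assms(3) by simp
  next
    case k: False
    with False have "vac = 0" using vac_mem bounded_below[of 0] by auto
    then show ?thesis using vac_right[of "pr n a b"] by (simp add: pr_linear)
  qed
  then show ?thesis using subspace_0[OF V_subspace] by simp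
qed

section \<open>Special cases of the Borcherds identity\<close>

lemma Sum_any_single:
  fixes f :: "'i \<Rightarrow> 'x::comm_monoid_add"
  assumes "\<And>j. j \<noteq> i \<Longrightarrow> f j = 0"
  shows "Sum_any f = f i"
  using Sum_any.expand_superset[of "{i}" f] assms by auto

text \<open>Borcherds identity at \<open>n = 0\<close>: the coefficients \<open>0 gchoose j\<close>
  leave only \<open>j = 0\<close> on the right, and since the outer index is a natural number the
  left sum stops at \<open>m\<close>.\<close>

lemma commutator:
  assumes "a \<in> V i p" "b \<in> V i' q"
  shows "pr (int m) a (pr l b c) - psign (p * q) *s pr l b (pr (int m) a c) =
    (\<Sum>j\<le>m. of_nat (m choose j) *s pr (int m + l - int j) (pr (int j) a b) c)"
proof -
  have "(\<Sum>j\<le>m. of_nat (m choose j) *s pr (int m + l - int j) (pr (int j) a b) c) =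
      Sum_any (\<lambda>j::nat. (of_int (int m) gchoose j) *s pr (int m + l - int j) (pr (0 + int j) a b) c)"
    by (subst Sum_any.expand_superset[of "{..m}"])
      (auto simp: binomial_eq_0_iff not_less simp flip: binomial_gbinomial)
  also have "\<dots> = Sum_any (\<lambda>j::nat. ((- 1) ^ j * (of_int 0 gchoose j)) *s
         (pr (int m + 0 - int j) a (pr (l + int j) b c)
          - ((- 1) powi 0 * psign (p * q)) *s pr (0 + l - int j) b (pr (int m + int j) a c)))"
    by (rule borcherds[OF assms])
  also have "\<dots> = pr (int m) a (pr l b c) - psign (p * q) *s pr l b (pr (int m) a c)"
    by (subst Sum_any_single[of 0]) (auto simp: gbinomial_0_left)
  finally show ?thesis ..
qed

lemma commutator_0:
  assumes "a \<in> V i p" "b \<in> V i' q"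
  shows "pr 0 a (pr l b c) = pr l (pr 0 a b) c + psign (p * q) *s pr l b (pr 0 a c)"
  using commutator[OF assms, of 0 l c] by (simp add: algebra_simps)

text \<open>The Borcherds identity at \<open>m = - 1\<close>, \<open>l = 0\<close> and \<open>c = vac\<close> is skew symmetry.\<close>

lemma skew_symmetry_leading:
  assumes "a \<in> V i p" "b \<in> V i' q" and zero: "\<And>j. j > n \<Longrightarrow> pr j a b = 0"
  shows "pr n a b = - (((- 1) powi n * psign (p * q)) *s pr n b a)"
proof -
  have "pr n a b = Sum_any (\<lambda>j::nat. (of_int (- 1) gchoose j) *s pr (- 1 + 0 - int j) (pr (n + int j) a b) vac)"
    \<comment> \<open>The terms \<open>j > 0\<close> contain products of index above
      \<open>n\<close>, which vanish by assumption; these are the corrections of the general skew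
      symmetry formula.\<close>
    by (subst Sum_any_single[of 0]) (auto simp: zero pr_linear vac_right)
  also have "\<dots> = Sum_any (\<lambda>j::nat. ((- 1) ^ j * (of_int n gchoose j)) *s
         (pr (- 1 + n - int j) a (pr (0 + int j) b vac)
          - ((- 1) powi n * psign (p * q)) *s pr (n + 0 - int j) b (pr (- 1 + int j) a vac)))"
    by (rule borcherds[OF assms(1,2)])
  also have "\<dots> = - (((- 1) powi n * psign (p * q)) *s pr n b a)"
    \<comment> \<open>Nonnegative products with \<open>vac\<close> vanish. This removes every first
      summand, and every second one except at \<open>j = 0\<close>, where
      \<open>pr (- 1) a vac = a\<close>.\<close>
    by (subst Sum_any_single[of 0]) (auto simp: vac_right_nonneg vac_right pr_linear)
  finally show ?thesis .
qed

text \<open>Borcherds identity at \<open>m = 0\<close>, \<open>n = l = - 1\<close>. The binomial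
  coefficient isolates the left side; on the right the assumptions remove all terms with
  \<open>a\<close> acting first on \<open>c\<close>, and those with
  \<open>pr (- 1 + int j) b c\<close> for \<open>j > 0\<close>.\<close>

lemma pr_minus_1_assoc:
  assumes "a \<in> V i p" "b \<in> V i' q"
    and "\<And>j. j \<ge> 0 \<Longrightarrow> pr j a c = 0" "\<And>j. j \<ge> 0 \<Longrightarrow> pr j b c = 0"
  shows "pr (- 1) (pr (- 1) a b) c = pr (- 1) a (pr (- 1) b c)"
proof -
  have "pr (- 1) (pr (- 1) a b) c =
      Sum_any (\<lambda>j::nat. (of_int 0 gchoose j) *s pr (0 + (- 1) - int j) (pr (- 1 + int j) a b) c)"
    by (subst Sum_any_single[of 0]) (auto simp: gbinomial_0_left)
  also have "\<dots> = Sum_any (\<lambda>j::nat. ((- 1) ^ j * (of_int (- 1) gchoose j)) *s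
         (pr (0 + (- 1) - int j) a (pr (- 1 + int j) b c)
          - ((- 1) powi (- 1) * psign (p * q)) *s pr (- 1 + (- 1) - int j) b (pr (0 + int j) a c)))"
    by (rule borcherds[OF assms(1,2)])
  also have "\<dots> = pr (- 1) a (pr (- 1) b c)"
    by (subst Sum_any_single[of 0]) (auto simp: assms(3,4) pr_linear)
  finally show ?thesis .
qed

text \<open>If the operator \<open>A\<^sub>(\<^sub>2\<^sub>) + B\<^sub>(\<^sub>1\<^sub>)\<close> vanishes, then so does its commutator with
  \<open>a\<^sub>(\<^sub>n\<^sub>)\<close>; evaluating that commutator on the vacuum for two values of \<open>n\<close> gives the claim.\<close>

lemma pr_0_zero:
  assumes A: "A \<in> V i p" and B: "B \<in> V i' p" and a: "a \<in> V j q"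
    and zero: "\<And>c. pr 2 A c + pr 1 B c = 0"
  shows "pr 0 A a = 0"
proof -
  \<comment> \<open>The commutators of \<open>pr 2 A\<close> and \<open>pr 1 B\<close> with
    \<open>pr n a\<close> sum to zero; their last terms \<open>pr n (pr 2 A a) vac\<close> and
    \<open>pr n (pr 1 B a) vac\<close> cancel by the hypothesis at \<open>a\<close>.\<close>
  have eq: "pr (2 + n) (pr 0 A a) vac + pr (1 + n) (2 *s pr 1 A a + pr 0 B a) vac = 0" for n
  proof -
    have "pr 2 A (pr n a vac) - psign (p * q) *s pr n a (pr 2 A vac) =
        pr (2 + n) (pr 0 A a) vac + 2 *s pr (1 + n) (pr 1 A a) vac + pr n (pr 2 A a) vac"
      using commutator[OF A a, of 2 n vac] by (simp add: numeral_2_eq_2 algebra_simps)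
    moreover have "pr 1 B (pr n a vac) - psign (p * q) *s pr n a (pr 1 B vac) =
        pr (1 + n) (pr 0 B a) vac + pr n (pr 1 B a) vac"
      using commutator[OF B a, of 1 n vac] by (simp add: algebra_simps)
    moreover have "pr 1 B c = - pr 2 A c" for c using zero[of c] by (simp add: eq_neg_iff_add_eq_0 add.commute)
    ultimately have "- pr (2 + n) (pr 0 A a) vac = pr (1 + n) (2 *s pr 1 A a + pr 0 B a) vac"
      by (simp add: pr_linear algebra_simps)
    then show ?thesis by (simp add: neg_eq_iff_add_eq_0)
  qed
  \<comment> \<open>At \<open>n = - 2\<close> the first term has index 0 on \<open>vac\<close> and
    vanishes, while the second has index \<open>- 1\<close> and returns its argument. With that
    argument gone, \<open>n = - 3\<close> does the same for \<open>pr 0 A a\<close>.\<close>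
  have "2 *s pr 1 A a + pr 0 B a = 0"
    using eq[of "- 2"] by (simp add: vac_right_nonneg vac_right)
  then show ?thesis using eq[of "- 3"] by (simp add: vac_right pr_linear)
qed

section \<open>The product on the lowest weight space\<close>

lemma pr_nonneg_lowest:
  assumes x: "x \<in> weight_space scale V k" and y: "y \<in> weight_space scale V k" and n: "n \<ge> 0"
  shows "pr n x y = 0"
proof -
  obtain x0 x1 where x': "x0 \<in> V k 0" "x1 \<in> V k 1" "x = x0 + x1"
    using x by (rule weight_space_cases)
  obtain y0 y1 where y': "y0 \<in> V k 0" "y1 \<in> V k 1" "y = y0 + y1"
    using y by (rule weight_space_cases)
  have "pr n u v = 0" if "u \<in> V k p" "v \<in> V k q" for u v p q
    using that n by (intro pr_above_weight) auto
  with x' y' show ?thesis by (simp add: pr_linear)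
qed

lemma pr_minus_1_lowest:
  assumes x: "x \<in> weight_space scale V k" and y: "y \<in> weight_space scale V k"
  shows "pr (- 1) x y \<in> weight_space scale V k"
proof -
  obtain x0 x1 where x': "x0 \<in> V k 0" "x1 \<in> V k 1" "x = x0 + x1"
    using x by (rule weight_space_cases)
  obtain y0 y1 where y': "y0 \<in> V k 0" "y1 \<in> V k 1" "y = y0 + y1"
    using y by (rule weight_space_cases)
  have "pr (- 1) u v \<in> weight_space scale V k" if "u \<in> V k p" "v \<in> V k q" for u v p q
    using pr_mem_lowest[OF that, of "- 1"] V_subset_weight_space by auto
  with x' y' show ?thesis by (auto simp: pr_linear intro!: subspace_add[OF weight_space_subspace])
qed

text \<open>All nonnegative products of \<open>x\<close> and \<open>y\<close> have weight below
  \<open>2 * k\<close> and vanish, so skew symmetry at index \<open>- 1\<close> has no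
  corrections.\<close>

lemma pr_minus_1_lowest_commute:
  assumes "x \<in> V k p" "y \<in> V k q"
  shows "pr (- 1) x y = psign (p * q) *s pr (- 1) y x"
  using skew_symmetry_leading[OF assms, of "- 1"] pr_above_weight[OF assms] by simp

text \<open>By supercommutativity the two halves of the symmetrised product coincide.\<close>

lemma tva_mult_lowest:
  assumes x: "x \<in> weight_space scale V k" and y: "y \<in> weight_space scale V k"
  shows "tva_mult scale V pr x y = pr (- 1) x y"
proof -
  obtain x0 x1 where x': "x0 \<in> V k 0" "x1 \<in> V k 1" "x = x0 + x1"
    using x by (rule weight_space_cases)
  obtain y0 y1 where y': "y0 \<in> V k 0" "y1 \<in> V k 1" "y = y0 + y1"
    using y by (rule weight_space_cases)
  have "tva_mult scale V pr u v = pr (- 1) u v" if "u \<in> V k p" "v \<in> V k q" for u v p q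
    unfolding tva_mult_homogeneous[OF that[THEN V_parity_space]]
      pr_minus_1_lowest_commute[OF that, symmetric] by (rule scale_half)
  with x' y' show ?thesis
    by (simp add: tva_mult_sum[OF x'(1,2)[THEN V_parity_space] y'(1,2)[THEN V_parity_space]] pr_linear)
qed

lemma pr_minus_1_lowest_assoc:
  assumes x: "x \<in> weight_space scale V k" and y: "y \<in> weight_space scale V k"
    and z: "z \<in> weight_space scale V k"
  shows "pr (- 1) (pr (- 1) x y) z = pr (- 1) x (pr (- 1) y z)"
proof -
  obtain x0 x1 where x': "x0 \<in> V k 0" "x1 \<in> V k 1" "x = x0 + x1"
    using x by (rule weight_space_cases)
  obtain y0 y1 where y': "y0 \<in> V k 0" "y1 \<in> V k 1" "y = y0 + y1"
    using y by (rule weight_space_cases)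
  have "pr (- 1) (pr (- 1) u v) z = pr (- 1) u (pr (- 1) v z)"
    if "u \<in> V k p" "v \<in> V k q" for u v p q
    using that V_subset_weight_space
    by (intro pr_minus_1_assoc[OF that] pr_nonneg_lowest z) auto
  with x' y' show ?thesis by (simp add: pr_linear)
qed

end

section \<open>Zero modes of \<open>G\<close>, \<open>Q\<close> and \<open>L\<close>, and the
  bracket on the lowest weight space\<close>

context topological_vertex_algebra
begin

lemma G0_mem: "x \<in> V i p \<Longrightarrow> pr 0 G x \<in> V (i + 1) (p + 1)"
  using pr_mem[OF G_mem, of x i p 0] by (simp add: add.commute)

lemma Q0_mem: "x \<in> V i p \<Longrightarrow> pr 0 Q x \<in> V i (p + 1)"
  using pr_mem[OF Q_mem, of x i p 0] by (simp add: add.commute)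

text \<open>As \<open>G\<close> is odd, its commutator formula doubles squares:
  \<open>pr 1 G\<close> gives \<open>pr 2 (pr 0 G G) + pr 1 (pr 1 G G) = 0\<close>, hence
  \<open>pr 0 (pr 0 G G) a = 0\<close> by \<open>pr_0_zero\<close>, and this is twice the square of
  \<open>pr 0 G\<close>.\<close>

lemma G0_square:
  assumes "a \<in> V i p"
  shows "pr 0 G (pr 0 G a) = 0"
proof -
  have A: "pr 0 G G \<in> V 3 0" and B: "pr 1 G G \<in> V 2 0"
    using pr_mem[OF G_mem G_mem, of 0] pr_mem[OF G_mem G_mem, of 1] by simp_all
  have "pr 2 (pr 0 G G) c + pr 1 (pr 1 G G) c = 0" for c
    using commutator[OF G_mem G_mem, of 1 1 c] by (simp add: G1_square psign_def)
  then have "pr 0 (pr 0 G G) a = 0" by (rule pr_0_zero[OF A B assms])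
  then have "pr 0 G (pr 0 G a) + pr 0 G (pr 0 G a) = 0"
    using commutator[OF G_mem G_mem, of 0 0 a] by (simp add: psign_def)
  then show ?thesis using scale_half[of "pr 0 G (pr 0 G a)"] by simp
qed

text \<open>Since \<^term>\<open>pr 1 L\<close> is the grading operator, its commutator with \<open>a\<^sub>(\<^sub>n\<^sub>)\<close> is known,
  which forces \<open>(L\<^sub>(\<^sub>0\<^sub>) a)\<^sub>(\<^sub>0\<^sub>) = 0\<close> although \<open>L\<^sub>(\<^sub>0\<^sub>)\<close> is not assumed to be the translation operator.\<close>

lemma L1_eigen: "a \<in> V i p \<Longrightarrow> pr 1 L a = of_int i *s a"
  using V_subset_weight_space[of i p] conformal_grading[of i] by (auto simp: integer_eigenspace_def)

lemma pr_0_L0: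
  assumes x: "x \<in> V i p" and y: "y \<in> weight_space scale V j"
  shows "pr 0 (pr 0 L x) y = 0"
proof -
  have hom: "pr 0 (pr 0 L x) v = 0" if v: "v \<in> V j q" for v q
  proof -
    \<comment> \<open>Index \<open>- 1\<close> adds weights, so the left side is \<open>i\<close>
      times \<open>pr (- 1) x v\<close>. The last term on the right is the same vector, and the
      remaining term must vanish.\<close>
    have "pr 1 L (pr (- 1) x v) - pr (- 1) x (pr 1 L v) =
        pr 0 (pr 0 L x) v + pr (- 1) (pr 1 L x) v"
      using commutator[OF L_mem x, of 1 "- 1" v] by (simp add: psign_def)
    moreover have "pr 1 L (pr (- 1) x v) = of_int (i + j) *s pr (- 1) x v"
      using L1_eigen[OF pr_mem[OF x v, of "- 1"]] by simp
    ultimately show ?thesis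
      by (simp add: L1_eigen[OF x] L1_eigen[OF v] pr_linear scale_left_distrib)
  qed
  from y obtain u v where "u \<in> V j 0" "v \<in> V j 1" "y = u + v" by (rule weight_space_cases)
  then show ?thesis using hom by (simp add: pr_linear)
qed

text \<open>Applying the odd derivation \<open>pr 0 G\<close> to \<open>pr 0 x y = 0\<close> moves
  \<open>G\<close> from \<open>x\<close> to \<open>y\<close>. Weight kills the positive products of
  \<open>x\<close> with \<open>pr 0 G y\<close>, so skew symmetry then exchanges the factors
  exactly. Thus both summands of the bracket agree.\<close>

lemma G0_symmetric:
  assumes x: "x \<in> V k p" and y: "y \<in> V k q"
  shows "psign (p * q) *s pr 0 (pr 0 G y) x = pr 0 (pr 0 G x) y"
proof -
  have "pr 0 x y = 0" using x y by (rule pr_above_weight) simp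
  then have "pr 0 (pr 0 G x) y = - (psign p *s pr 0 x (pr 0 G y))"
    using commutator_0[OF G_mem x, of 0 y, unfolded mult_1_left]
    by (simp add: pr_linear eq_neg_iff_add_eq_0)
  also have "pr 0 x (pr 0 G y) = - (psign (p * (q + 1)) *s pr 0 (pr 0 G y) x)"
    using skew_symmetry_leading[OF x G0_mem[OF y], of 0] pr_above_weight[OF x G0_mem[OF y]]
    by simp
  finally show ?thesis
    using bit_exhaust[of p] bit_exhaust[of q] by (auto simp: psign_def)
qed

text \<open>Replacing \<open>x0 + x1\<close> by \<open>x0 - x1\<close> applies the parity
  involution, which absorbs the sign \<open>psign p\<close> for inhomogeneous arguments; bilinearity
  can be read off this form.\<close>

lemma tva_bracket_lowest:
  assumes x: "x0 \<in> V k 0" "x1 \<in> V k 1" and y: "y \<in> weight_space scale V k"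
  shows "tva_bracket scale V pr G (x0 + x1) y = pr 0 (pr 0 G (x0 - x1)) y"
proof -
  obtain y0 y1 where y': "y0 \<in> V k 0" "y1 \<in> V k 1" "y = y0 + y1"
    using y by (rule weight_space_cases)
  have "psign p *s tva_bracket scale V pr G u v = pr 0 (pr 0 G u) v"
    if "u \<in> V k p" "v \<in> V k q" for u v p q
    unfolding tva_bracket_homogeneous[OF that[THEN V_parity_space]] G0_symmetric[OF that]
    by (rule scale_half)
  from this[OF x(1) y'(1)] this[OF x(1) y'(2)] this[OF x(2) y'(1)] this[OF x(2) y'(2)]
  have "tva_bracket scale V pr G x0 y0 = pr 0 (pr 0 G x0) y0"
    "tva_bracket scale V pr G x0 y1 = pr 0 (pr 0 G x0) y1"
    "tva_bracket scale V pr G x1 y0 = - pr 0 (pr 0 G x1) y0"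
    "tva_bracket scale V pr G x1 y1 = - pr 0 (pr 0 G x1) y1"
    by (simp_all add: psign_def minus_equation_iff[of "tva_bracket scale V pr G _ _"])
  then show ?thesis
    by (simp add: y'(3) pr_linear tva_bracket_sum[OF x[THEN V_parity_space] y'(1,2)[THEN V_parity_space]])
qed

lemma tva_bracket_lowest_homogeneous:
  assumes x: "x \<in> V k p" and y: "y \<in> weight_space scale V k"
  shows "tva_bracket scale V pr G x y = psign p *s pr 0 (pr 0 G x) y"
  using bit_exhaust[of p] tva_bracket_lowest[OF _ _ y, of x 0] tva_bracket_lowest[OF _ _ y, of 0 x] x
  by (auto simp: psign_def subspace_0[OF V_subspace] pr_linear)

lemma pr_0_G0_lowest:
  assumes x: "x \<in> V k p" and y: "y \<in> weight_space scale V k"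
  shows "pr 0 (pr 0 G x) y \<in> weight_space scale V k"
proof -
  have *: "pr 0 (pr 0 G x) v \<in> weight_space scale V k" if "v \<in> V k q" for v q
    using pr_mem_lowest[OF G0_mem[OF x] that, of 0] V_subset_weight_space by auto
  from y obtain u v where "u \<in> V k 0" "v \<in> V k 1" "y = u + v" by (rule weight_space_cases)
  with * show ?thesis by (simp add: pr_linear subspace_add[OF weight_space_subspace])
qed

lemma tva_bracket_bilinear:
  "bilinear_on scale (weight_space scale V k) (tva_bracket scale V pr G)"
proof -
  let ?A = "weight_space scale V k" and ?br = "tva_bracket scale V pr G"
  have mem: "?br x y \<in> ?A" if x: "x \<in> ?A" and y: "y \<in> ?A" for x y
  proof -
    obtain x0 x1 where x': "x0 \<in> V k 0" "x1 \<in> V k 1" "x = x0 + x1"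
      using x by (rule weight_space_cases)
    show ?thesis
      by (simp add: x'(3) tva_bracket_lowest[OF x'(1,2) y] pr_linear
          subspace_diff[OF weight_space_subspace] pr_0_G0_lowest[OF _ y] x'(1,2)[THEN pr_0_G0_lowest[OF _ y]])
  qed
  have left: "?br (x + x') y = ?br x y + ?br x' y \<and> ?br (c *s x) y = c *s ?br x y"
    if x: "x \<in> ?A" and x': "x' \<in> ?A" and y: "y \<in> ?A" for x x' y c
  proof -
    obtain u v where uv: "u \<in> V k 0" "v \<in> V k 1" "x = u + v"
      using x by (rule weight_space_cases)
    obtain u' v' where uv': "u' \<in> V k 0" "v' \<in> V k 1" "x' = u' + v'"
      using x' by (rule weight_space_cases)
    have "?br (x + x') y = ?br ((u + u') + (v + v')) y" by (simp add: uv uv' ac_simps)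
    also have "\<dots> = ?br x y + ?br x' y"
      using tva_bracket_lowest[OF uv(1,2) y] tva_bracket_lowest[OF uv'(1,2) y]
        tva_bracket_lowest[OF subspace_add[OF V_subspace uv(1) uv'(1)]
          subspace_add[OF V_subspace uv(2) uv'(2)] y]
      by (simp add: uv(3) uv'(3) pr_linear)
    finally have "?br (x + x') y = ?br x y + ?br x' y" .
    moreover have "?br (c *s x) y = c *s ?br x y"
      using tva_bracket_lowest[OF uv(1,2) y]
        tva_bracket_lowest[OF subspace_scale[OF V_subspace uv(1), of c]
          subspace_scale[OF V_subspace uv(2), of c] y]
      by (simp add: uv(3) pr_linear scale_right_distrib scale_right_diff_distrib)
    ultimately show ?thesis ..
  qed
  have right: "?br x (y + y') = ?br x y + ?br x y' \<and> ?br x (c *s y) = c *s ?br x y"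
    if x: "x \<in> ?A" and y: "y \<in> ?A" and y': "y' \<in> ?A" for x y y' c
  proof -
    obtain u v where uv: "u \<in> V k 0" "v \<in> V k 1" "x = u + v"
      using x by (rule weight_space_cases)
    note tva_bracket_lowest[OF uv(1,2), folded uv(3)]
    then show ?thesis
      using y y' by (simp add: subspace_add[OF weight_space_subspace]
          subspace_scale[OF weight_space_subspace] pr_linear scale_right_diff_distrib)
  qed
  show ?thesis unfolding bilinear_on_def using mem left right by blast
qed

lemma tva_mult_bilinear:
  "bilinear_on scale (weight_space scale V k) (tva_mult scale V pr)"
  unfolding bilinear_on_def
  by (simp add: tva_mult_lowest pr_minus_1_lowest subspace_add[OF weight_space_subspace]
      subspace_scale[OF weight_space_subspace] pr_linear)

section \<open>Fermionic degree, parity and weight\<close>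

lemma Q0_lowest:
  assumes "x \<in> weight_space scale V i"
  shows "pr 0 Q x \<in> weight_space scale V i"
proof -
  obtain u v where "u \<in> V i 0" "v \<in> V i 1" "x = u + v"
    using assms by (rule weight_space_cases)
  then have "pr 0 Q u \<in> weight_space scale V i"
    "pr 0 Q v \<in> weight_space scale V i" "pr 0 Q x = pr 0 Q u + pr 0 Q v"
    using Q0_mem V_subset_weight_space by (fast, fast, simp add: pr_linear)
  then show ?thesis by (simp add: subspace_add[OF weight_space_subspace])
qed

text \<open>\<open>pr 0 J\<close> is an even derivation of every product, so its eigenvalues
  add.\<close>

lemma fermionic_pr:
  assumes "a \<in> V i p" "a \<in> fermionic_space scale pr J f" "b \<in> fermionic_space scale pr J g"
  shows "pr n a b \<in> fermionic_space scale pr J (f + g)"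
  using commutator_0[OF J_mem assms(1), of n b] assms(2,3)
  by (simp add: fermionic_space_def integer_eigenspace_def pr_linear psign_def scale_left_distrib)

lemma fermionic_lowest:
  assumes "x \<in> weight_space scale V i \<inter> fermionic_space scale pr J m"
  shows "x \<in> V i (of_int m)"
  using assms fermionic_parity by (auto intro: weight_parity_space)

lemma fermionic_scale: "x \<in> fermionic_space scale pr J m \<Longrightarrow> c *s x \<in> fermionic_space scale pr J m"
  by (simp add: fermionic_space_def integer_eigenspace_def pr_linear scale_left_commute)

section \<open>Identities of the bracket and the differential, in terms of parities\<close>

lemma tva_bracket_mem:
  assumes x: "x \<in> V k p" and y: "y \<in> V k q"
  shows "tva_bracket scale V pr G x y \<in> V k (p + 1 + q)"
proof -
  have "y \<in> weight_space scale V k" using y V_subset_weight_space by blast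
  then show ?thesis
    using pr_mem_lowest[OF G0_mem[OF x] y, of 0]
    by (simp only: tva_bracket_lowest_homogeneous[OF x] subspace_scale[OF V_subspace])
qed

text \<open>The factors \<open>psign p\<close> and \<open>psign q\<close> turn the symmetry
  \<open>G0_symmetric\<close> into antisymmetry for shifted parities, because
  \<open>(p + 1) * (q + 1) = p * q + p + q + 1\<close>.\<close>

lemma tva_bracket_antisymmetric:
  assumes x: "x \<in> V k p" and y: "y \<in> V k q"
  shows "tva_bracket scale V pr G x y =
    - (psign ((p + 1) * (q + 1)) *s tva_bracket scale V pr G y x)"
proof -
  have "x \<in> weight_space scale V k" "y \<in> weight_space scale V k"
    using x y V_subset_weight_space by blast+
  then show ?thesis
    using bit_exhaust[of p] bit_exhaust[of q] G0_symmetric[OF x y]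
    by (auto simp: tva_bracket_lowest_homogeneous[OF x] tva_bracket_lowest_homogeneous[OF y] psign_def)
qed

text \<open>Since \<open>pr 0 G\<close> kills \<open>?X\<close>, it maps \<open>pr 0 ?X y\<close> to
  \<open>pr 0 ?X ?Y\<close> up to sign. The identity thus becomes the supercommutator formula for
  the operators \<open>pr 0 ?X\<close> and \<open>pr 0 ?Y\<close>.\<close>

lemma tva_bracket_jacobi:
  assumes x: "x \<in> V k p" and y: "y \<in> V k q" and z: "z \<in> weight_space scale V k"
  shows "tva_bracket scale V pr G x (tva_bracket scale V pr G y z) =
    tva_bracket scale V pr G (tva_bracket scale V pr G x y) z +
    psign ((p + 1) * (q + 1)) *s tva_bracket scale V pr G y (tva_bracket scale V pr G x z)"
proof -
  let ?X = "pr 0 G x" and ?Y = "pr 0 G y"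
  have y': "y \<in> weight_space scale V k" using y V_subset_weight_space by blast
  have br: "tva_bracket scale V pr G x v = psign p *s pr 0 ?X v"
    "tva_bracket scale V pr G y v = psign q *s pr 0 ?Y v" if "v \<in> weight_space scale V k" for v
    using tva_bracket_lowest_homogeneous[OF x that] tva_bracket_lowest_homogeneous[OF y that] .
  have mem: "psign p *s pr 0 ?X z \<in> weight_space scale V k" "psign q *s pr 0 ?Y z \<in> weight_space scale V k"
    using x y z by (simp_all add: pr_0_G0_lowest subspace_scale[OF weight_space_subspace])
  have outer: "tva_bracket scale V pr G x (tva_bracket scale V pr G y z) =
      psign p *s psign q *s pr 0 ?X (pr 0 ?Y z)"
    "tva_bracket scale V pr G y (tva_bracket scale V pr G x z) =
      psign q *s psign p *s pr 0 ?Y (pr 0 ?X z)"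
    by (simp_all only: br z mem pr_linear)
  have "pr 0 G (pr 0 ?X y) = psign (p + 1) *s pr 0 ?X ?Y"
    using commutator_0[OF G_mem G0_mem[OF x], of 0 y, unfolded mult_1_left]
    by (simp only: G0_square[OF x] pr_linear add_0_left)
  moreover have "pr 0 (pr 0 ?X ?Y) z =
      pr 0 ?X (pr 0 ?Y z) - psign ((p + 1) * (q + 1)) *s pr 0 ?Y (pr 0 ?X z)"
    using commutator_0[OF G0_mem[OF x] G0_mem[OF y], of 0 z] by simp
  moreover have "tva_bracket scale V pr G (tva_bracket scale V pr G x y) z =
      psign (p + 1 + q) *s pr 0 (pr 0 G (psign p *s pr 0 ?X y)) z"
    using tva_bracket_lowest_homogeneous[OF tva_bracket_mem[OF x y] z] by (simp only: br y')
  ultimately show ?thesis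
    using bit_exhaust[of p] bit_exhaust[of q]
    by (auto simp: outer psign_def pr_linear)
qed

text \<open>Up to sign the bracket with \<open>x\<close> is the zero mode of
  \<open>pr 0 G x\<close>, a superderivation of parity \<open>p + 1\<close>.\<close>

lemma tva_bracket_derivation:
  assumes x: "x \<in> V k p" and y: "y \<in> V k q" and z: "z \<in> weight_space scale V k"
  shows "tva_bracket scale V pr G x (tva_mult scale V pr y z) =
    tva_mult scale V pr (tva_bracket scale V pr G x y) z +
    psign ((p + 1) * q) *s tva_mult scale V pr y (tva_bracket scale V pr G x z)"
proof -
  have y': "y \<in> weight_space scale V k" using y V_subset_weight_space by blast
  show ?thesis
    using commutator_0[OF G0_mem[OF x] y, of "- 1" z]
    by (simp only: tva_mult_lowest tva_bracket_lowest_homogeneous[OF x] y' z pr_minus_1_lowest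
        pr_0_G0_lowest[OF x] subspace_scale[OF weight_space_subspace] pr_linear scale_right_distrib
        scale_left_commute[of "psign p"])
qed

lemma Q0_tva_mult:
  assumes x: "x \<in> V k p" and y: "y \<in> weight_space scale V k"
  shows "pr 0 Q (tva_mult scale V pr x y) =
    tva_mult scale V pr (pr 0 Q x) y + psign p *s tva_mult scale V pr x (pr 0 Q y)"
proof -
  have "x \<in> weight_space scale V k" using x V_subset_weight_space by blast
  then show ?thesis
    using commutator_0[OF Q_mem x, of "- 1" y, unfolded mult_1_left]
    by (simp only: tva_mult_lowest Q0_lowest y)
qed

text \<open>Moving \<open>pr 0 Q\<close> past \<open>pr 0 G\<close> costs \<open>pr 0 L x\<close>,
  whose zero mode vanishes on weight spaces by \<open>pr_0_L0\<close>. The sign from anticommuting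
  matches the opposite parity of \<open>pr 0 Q x\<close>.\<close>

lemma Q0_tva_bracket:
  assumes x: "x \<in> V k p" and y: "y \<in> weight_space scale V k"
  shows "pr 0 Q (tva_bracket scale V pr G x y) =
    tva_bracket scale V pr G (pr 0 Q x) y + psign (p + 1) *s tva_bracket scale V pr G x (pr 0 Q y)"
proof -
  have "pr 0 Q (pr 0 G x) = pr 0 L x - pr 0 G (pr 0 Q x)"
    using Q0_G[of 0 x] by (simp add: algebra_simps)
  then have "pr 0 (pr 0 Q (pr 0 G x)) y = - pr 0 (pr 0 G (pr 0 Q x)) y"
    by (simp only: pr_linear pr_0_L0[OF x y] diff_0)
  then have "pr 0 Q (pr 0 (pr 0 G x) y) =
      - pr 0 (pr 0 G (pr 0 Q x)) y + psign (p + 1) *s pr 0 (pr 0 G x) (pr 0 Q y)"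
    using commutator_0[OF Q_mem G0_mem[OF x], of 0 y, unfolded mult_1_left] by (simp only:)
  then show ?thesis
    using bit_exhaust[of p]
    by (auto simp: tva_bracket_lowest_homogeneous[OF x] tva_bracket_lowest_homogeneous[OF Q0_mem[OF x]]
        y Q0_lowest psign_def pr_linear)
qed

text \<open>The lowest weight space is an eigenspace of \<open>pr 1 L\<close>, which commutes with
  the diagonalizable operator \<open>pr 0 J\<close>.\<close>

lemma fermionic_decomposition:
  "internal_direct_sum scale
    (\<lambda>f. weight_space scale V k \<inter> fermionic_space scale pr J f) (weight_space scale V k)"
  unfolding conformal_grading fermionic_space_def
  by (rule internal_direct_sum_eigenspace[OF J0_diagonalizable linear_right linear_right L1_J0_commute])

section \<open>Passage from parities to fermionic degrees\<close>

abbreviation fermionic_part :: "int \<Rightarrow> 'v set" where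
  "fermionic_part f \<equiv> weight_space scale V k \<inter> fermionic_space scale pr J f"

lemma tva_mult_degree:
  assumes x: "x \<in> fermionic_part m" and y: "y \<in> fermionic_part n"
  shows "tva_mult scale V pr x y \<in> fermionic_part (m + n)"
  using assms fermionic_pr[OF fermionic_lowest[OF x]] by (simp add: tva_mult_lowest pr_minus_1_lowest)

lemma tva_bracket_degree:
  assumes x: "x \<in> fermionic_part m" and y: "y \<in> fermionic_part n"
  shows "tva_bracket scale V pr G x y \<in> fermionic_part (m + n - 1)"
proof -
  have x': "x \<in> V k (of_int m)" using x by (rule fermionic_lowest)
  have "pr 0 G x \<in> fermionic_space scale pr J (- 1 + m)"
    using x by (intro fermionic_pr[OF G_mem G_fermionic]) simp
  then have "pr 0 (pr 0 G x) y \<in> fermionic_space scale pr J (- 1 + m + n)"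
    using y by (intro fermionic_pr[OF G0_mem[OF x']]) auto
  moreover have "- 1 + m + n = m + n - 1" by simp
  ultimately show ?thesis
    using y by (simp only: tva_bracket_lowest_homogeneous[OF x'] pr_0_G0_lowest[OF x'] Int_iff
        fermionic_scale subspace_scale[OF weight_space_subspace])
qed

lemma Q0_degree:
  assumes "x \<in> fermionic_part m"
  shows "pr 0 Q x \<in> fermionic_part (m + 1)"
  using assms fermionic_pr[OF Q_mem Q_fermionic, of x m 0] by (simp add: Q0_lowest add.commute)

lemma graded_commutative_associative_lowest:
  "graded_commutative_associative scale (weight_space scale V k) fermionic_part (tva_mult scale V pr)"
proof -
  have "tva_mult scale V pr x y = ((- 1) powi (m * n)) *s tva_mult scale V pr y x"
    if x: "x \<in> fermionic_part m" and y: "y \<in> fermionic_part n" for m n x y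
    using x y pr_minus_1_lowest_commute[OF fermionic_lowest[OF x] fermionic_lowest[OF y]]
    by (simp only: tva_mult_lowest Int_iff of_int_mult flip: psign_of_int)
  then show ?thesis
    unfolding graded_commutative_associative_def bilinear_of_degree_def
    using tva_mult_degree tva_mult_bilinear
    by (simp add: tva_mult_lowest pr_minus_1_lowest pr_minus_1_lowest_assoc)
qed

lemma shift1_fermionic_lowest:
  assumes "x \<in> shift1 fermionic_part m"
  shows "x \<in> V k (of_int m + 1)"
  using fermionic_lowest[of x k "m + 1"] assms by (simp only: shift1_def of_int_add of_int_1)

text \<open>Shifted degree \<open>m\<close> means parity \<open>m + 1\<close>, and the bracket signs
  add another 1; the two cancel in \<open>bit\<close>.\<close>

lemma psign_shift: "psign ((of_int m + 1 + 1) * (of_int n + 1 + 1)) = ((- 1) powi (m * n) :: 'k)"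
  by (simp only: add.assoc one_add_one bit_numeral_even add_0_right of_int_mult flip: psign_of_int)

lemma graded_lie_algebra_lowest:
  "graded_lie_algebra scale (weight_space scale V k) (shift1 fermionic_part) (tva_bracket scale V pr G)"
proof -
  have "tva_bracket scale V pr G x y \<in> shift1 fermionic_part (m + n)"
    if "x \<in> shift1 fermionic_part m" "y \<in> shift1 fermionic_part n" for m n x y
    using tva_bracket_degree[of x "m + 1" y "n + 1"] that by (simp add: shift1_def algebra_simps)
  moreover have "tva_bracket scale V pr G x y =
      - (((- 1) powi (m * n)) *s tva_bracket scale V pr G y x)"
    if x: "x \<in> shift1 fermionic_part m" and y: "y \<in> shift1 fermionic_part n" for m n x y
    using tva_bracket_antisymmetric[OF shift1_fermionic_lowest[OF x] shift1_fermionic_lowest[OF y]]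
    unfolding psign_shift .
  moreover have "tva_bracket scale V pr G x (tva_bracket scale V pr G y z) =
      tva_bracket scale V pr G (tva_bracket scale V pr G x y) z +
      ((- 1) powi (m * n)) *s tva_bracket scale V pr G y (tva_bracket scale V pr G x z)"
    if x: "x \<in> shift1 fermionic_part m" and y: "y \<in> shift1 fermionic_part n"
      and z: "z \<in> weight_space scale V k" for m n x y z
    using tva_bracket_jacobi[OF shift1_fermionic_lowest[OF x] shift1_fermionic_lowest[OF y] z]
    unfolding psign_shift .
  ultimately show ?thesis
    unfolding graded_lie_algebra_def bilinear_of_degree_def add_0_right
    using tva_bracket_bilinear by blast
qed

lemma graded_derivation_tva_bracket:
  assumes x: "x \<in> fermionic_part m"
  shows "graded_derivation scale (weight_space scale V k) fermionic_part (tva_mult scale V pr)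
    (m - 1) (tva_bracket scale V pr G x)"
proof -
  have "linear_on scale (weight_space scale V k) (tva_bracket scale V pr G x)"
    using tva_bracket_bilinear x by (simp add: bilinear_on_def linear_on_def)
  moreover have "tva_bracket scale V pr G x y \<in> fermionic_part (n + (m - 1))"
    if "y \<in> fermionic_part n" for n y
    using tva_bracket_degree[OF x that] by (simp add: algebra_simps)
  moreover have "tva_bracket scale V pr G x (tva_mult scale V pr y z) =
      tva_mult scale V pr (tva_bracket scale V pr G x y) z +
      ((- 1) powi ((m - 1) * n)) *s tva_mult scale V pr y (tva_bracket scale V pr G x z)"
    if y: "y \<in> fermionic_part n" and z: "z \<in> weight_space scale V k" for n y z
  proof -
    \<comment> \<open>The bracket with \<open>x\<close> has degree \<open>m - 1\<close> but parity
      \<open>m + 1\<close>; these agree modulo 2.\<close>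
    have "(of_int m + 1) * of_int n = (of_int ((m - 1) * n) :: bit)" by simp
    then show ?thesis
      using tva_bracket_derivation[OF fermionic_lowest[OF x] fermionic_lowest[OF y] z]
      by (simp only: psign_of_int)
  qed
  ultimately show ?thesis unfolding graded_derivation_def by blast
qed

lemma linear_on_Q0: "linear_on scale (weight_space scale V k) (pr 0 Q)"
  by (simp add: linear_on_def Q0_lowest pr_linear)

lemma graded_derivation_Q0_mult:
  "graded_derivation scale (weight_space scale V k) fermionic_part (tva_mult scale V pr) 1 (pr 0 Q)"
  unfolding graded_derivation_def mult_1_left
  using linear_on_Q0 Q0_degree Q0_tva_mult[OF fermionic_lowest, unfolded psign_of_int] by blast

lemma graded_derivation_Q0_bracket:
  "graded_derivation scale (weight_space scale V k) (shift1 fermionic_part)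
    (tva_bracket scale V pr G) 1 (pr 0 Q)"
proof -
  have "pr 0 Q x \<in> shift1 fermionic_part (m + 1)" if "x \<in> shift1 fermionic_part m" for m x
    using that unfolding shift1_def by (rule Q0_degree)
  moreover have "pr 0 Q (tva_bracket scale V pr G x y) =
      tva_bracket scale V pr G (pr 0 Q x) y +
      ((- 1) powi m) *s tva_bracket scale V pr G x (pr 0 Q y)"
    if x: "x \<in> shift1 fermionic_part m" and y: "y \<in> weight_space scale V k" for m x y
    using Q0_tva_bracket[OF shift1_fermionic_lowest[OF x] y]
    by (simp only: add.assoc one_add_one bit_numeral_even add_0_right psign_of_int)
  ultimately show ?thesis
    unfolding graded_derivation_def mult_1_left using linear_on_Q0 by blast
qed

end

theorem lemma4p3:
  fixes scale :: "'k::field_char_0 \<Rightarrow> 'v::ab_group_add \<Rightarrow> 'v"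
    and k :: int
    and V :: "int \<Rightarrow> bit \<Rightarrow> 'v set"
    and pr :: "int \<Rightarrow> 'v \<Rightarrow> 'v \<Rightarrow> 'v"
    and vac L G Q J :: 'v
  assumes "topological_vertex_algebra scale k V pr vac L G Q J"
  shows "differential_gerstenhaber_algebra scale
           (weight_space scale V k)
           (\<lambda>f. weight_space scale V k \<inter> fermionic_space scale pr J f)
           (tva_mult scale V pr)
           (tva_bracket scale V pr G)
           (pr 0 Q)"
proof -
  interpret topological_vertex_algebra scale k V pr vac L G Q J by (rule assms)
  have "bilinear_of_degree scale (weight_space scale V k) fermionic_part 0 (tva_mult scale V pr)"
    using graded_commutative_associative_lowest by (simp add: graded_commutative_associative_def)
  moreover have "bilinear_of_degree scale (weight_space scale V k) fermionic_part (- 1) (tva_bracket scale V pr G)"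
    unfolding bilinear_of_degree_def add_uminus_conv_diff
    using tva_bracket_bilinear tva_bracket_degree by blast
  ultimately show ?thesis
    unfolding differential_gerstenhaber_algebra_def gerstenhaber_algebra_def
    using vector_space_axioms weight_space_subspace fermionic_decomposition
      graded_commutative_associative_lowest graded_lie_algebra_lowest
      graded_derivation_tva_bracket Q0_square graded_derivation_Q0_mult graded_derivation_Q0_bracket
    by blast
qed

end
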